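(* Let $\mu\in\mathcal P_4(\mathbb R^{d_x})$, $\nu\in\mathcal P_4(\mathbb R^{d_y})$ and let $M_{\mu,\nu}:=\sqrt{M_2(\mu)M_2(\nu)}$. Then $$\mathsf S^2(\mu,\nu)=\inf_{\mathbf A\in\mathbb R^{d_x\times d_y}}\Big\{32\|\mathbf A\|_{\mathrm F}^2+\mathsf{OT}_{\mathbf A}(\mu,\nu)\Big\},$$ and the infimum is achieved at some $\mathbf A^\star\in\mathcal D_{M_{\mu,\nu}}:=[-M_{\mu,\nu}/2,\,M_{\mu,\nu}/2]^{d_x\times d_y}$.
   Context: $\mathcal P_p(\mathbb R^d)$ is the set of Borel probability measures $\rho$ on $\mathbb R^d$ with $M_p(\rho):=\int\|x\|^p\,d\rho(x)<\infty$. $\Pi(\mu,\nu)$ is the set of couplings of $\mu$ and $\nu$. $\|\cdot\|_{\mathrm F}$ is the Frobenius norm. The functional $\mathsf S^2$ (the coupling-dependent part of the squared $(2,2)$-Gromov-Wasserstein distance) is $$\mathsf S^2(\mu,\nu):=\inf_{\pi\in\Pi(\mu,\nu)}\int -4\|x\|^2\|y\|^2\,d\pi(x,y)-8\sum_{\substack{1\le i\le d_x\\1\le j\le d_y}}\Big(\int x_iy_j\,d\pi(x,y)\Big)^2.$$ For $\mathbf A\in\mathbb R^{d_x\times d_y}$, $\mathsf{OT}_{\mathbf A}(\mu,\nu):=\inf_{\pi\in\Pi(\mu,\nu)}\int c_{\mathbf A}\,d\pi$ is the optimal transport problem with cost $c_{\mathbf A}(x,y):=-4\|x\|^2\|y\|^2-32\,x^{\intercal}\mathbf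 A y$, $(x,y)\in\mathbb R^{d_x}\times\mathbb R^{d_y}$. *)

theory Defs
  imports "HOL-Probability.Probability"
begin

definition moment :: "nat \<Rightarrow> 'a::euclidean_space measure \<Rightarrow> real" where
  "moment p \<rho> = (\<integral>x. norm x ^ p \<partial>\<rho>)"

text \<open>For a Borel measure, integrability of the nonnegative function \<open>norm x ^ p\<close> is finiteness of
  its \<open>p\<close>-th moment; \<open>moment p \<rho>\<close> is then the actual moment and not the default value of the Bochner
  integral.\<close>

definition prob_measures :: "nat \<Rightarrow> 'a::euclidean_space measure set" where
  "prob_measures p =
     {\<rho>. prob_space \<rho> \<and> sets \<rho> = sets borel \<and> integrable \<rho> (\<lambda>x. norm x ^ p)}"

definition couplings ::
  "'a::euclidean_space measure \<Rightarrow> 'b::euclidean_space measure \<Rightarrow> ('a \<times> 'b) measure set" where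
  "couplings \<mu> \<nu> =
     {\<pi>. prob_space \<pi> \<and> sets \<pi> = sets borel \<and> distr \<pi> borel fst = \<mu> \<and> distr \<pi> borel snd = \<nu>}"

text \<open>The infima below are taken in the extended reals, where they exist unconditionally. When both
  marginals have finite fourth moments, every integrand is integrable under every coupling.\<close>

definition S2 :: "(real ^ 'm) measure \<Rightarrow> (real ^ 'n) measure \<Rightarrow> ereal" where
  "S2 \<mu> \<nu> = (INF \<pi>\<in>couplings \<mu> \<nu>.
     ereal ((\<integral>(x, y). - 4 * (norm x)\<^sup>2 * (norm y)\<^sup>2 \<partial>\<pi>)
            - 8 * (\<Sum>i\<in>UNIV. \<Sum>j\<in>UNIV. (\<integral>(x, y). x $ i * y $ j \<partial>\<pi>)\<^sup>2)))"

definition cost :: "real ^ 'n ^ 'm \<Rightarrow> real ^ 'm \<Rightarrow> real ^ 'n \<Rightarrow> real" where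
  "cost A x y = - 4 * (norm x)\<^sup>2 * (norm y)\<^sup>2 - 32 * (x \<bullet> (A *v y))"

definition OT :: "real ^ 'n ^ 'm \<Rightarrow> (real ^ 'm) measure \<Rightarrow> (real ^ 'n) measure \<Rightarrow> ereal" where
  "OT A \<mu> \<nu> = (INF \<pi>\<in>couplings \<mu> \<nu>. ereal (\<integral>(x, y). cost A x y \<partial>\<pi>))"

definition frobenius_norm :: "real ^ 'n ^ 'm \<Rightarrow> real" where
  "frobenius_norm A = sqrt (\<Sum>i\<in>UNIV. \<Sum>j\<in>UNIV. (A $ i $ j)\<^sup>2)"

lemma frobenius_norm_eq_norm: "frobenius_norm A = norm A"
  by (simp add: frobenius_norm_def norm_vec_def L2_set_def sum_nonneg)

definition matrix_box :: "real \<Rightarrow> (real ^ 'n ^ 'm) set" where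
  "matrix_box M = {A. \<forall>i j. A $ i $ j \<in> {- M / 2 .. M / 2}}"

end

theory Submission imports Defs begin

text \<open>
  The identity linearises the concave part of the functional by completing a square. For a coupling
  \<open>\<pi>\<close> let \<open>C\<close> be the cross-correlation matrix, \<open>C\<^sub>i\<^sub>j = \<integral> x\<^sub>i y\<^sub>j d\<pi>\<close>, and let \<open>K\<close> be the integral of
  \<open>- 4 \<parallel>x\<parallel>\<^sup>2 \<parallel>y\<parallel>\<^sup>2\<close>. Then
  \<open>32 \<parallel>A\<parallel>\<^sup>2 + \<integral> c\<^sub>A d\<pi> = 32 \<parallel>A\<parallel>\<^sup>2 + K - 32 \<langle>A, C\<rangle> = (K - 8 \<parallel>C\<parallel>\<^sup>2) + 32 \<parallel>A - C / 2\<parallel>\<^sup>2\<close>,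
  whose minimum over \<open>A\<close> is the objective of \<open>S2\<close>, attained at \<open>A = C / 2\<close>. Exchanging the two
  infima gives the identity. By the Cauchy-Schwarz inequality \<open>C / 2\<close> lies in the box, so the
  infimum over all matrices equals the one over the box.

  For the attainment neither existence nor compactness of optimal couplings is needed.
  The map \<open>A \<mapsto> OT A\<close> is an infimum of affine functions of \<open>A\<close> whose slopes \<open>- 32 C\<close> are bounded
  uniformly in \<open>\<pi>\<close>, so it is continuous, and a continuous function on the compact box attains its
  minimum. The argument is carried out in the abstract for a family of pairs \<open>(K, C)\<close> indexed by an
  arbitrary set, as \<open>quadratic_linearisation\<close>; with extended real infima, it requires neither that
  the index set be nonempty nor that \<open>K\<close> be bounded below.
\<close>

section \<open>Infima of uniformly Lipschitz families\<close>

lemma INF_lipschitz_le: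
  fixes f :: "'i \<Rightarrow> 'a::metric_space \<Rightarrow> real"
  assumes "\<And>p x y. p \<in> P \<Longrightarrow> f p x \<le> f p y + L * dist x y"
  shows "(INF p\<in>P. ereal (f p x)) \<le> (INF p\<in>P. ereal (f p y)) + ereal (L * dist x y)"
proof -
  have "(INF p\<in>P. ereal (f p x)) - ereal (L * dist x y) \<le> (INF p\<in>P. ereal (f p y))"
  proof (rule INF_greatest)
    fix p assume p: "p \<in> P"
    have "(INF p\<in>P. ereal (f p x)) \<le> ereal (f p x)"
      using p by (rule INF_lower)
    also have "\<dots> \<le> ereal (f p y) + ereal (L * dist x y)"
      using assms[OF p] by simp
    finally show "(INF p\<in>P. ereal (f p x)) - ereal (L * dist x y) \<le> ereal (f p y)"
      by (simp add: ereal_minus_le)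
  qed
  then show ?thesis
    by (simp add: ereal_minus_le)
qed

text \<open>The infimum may take infinite values; the two-sided Lipschitz estimate still squeezes it, since
  adding a finite quantity is continuous on the extended reals.\<close>

lemma continuous_on_INF_lipschitz:
  fixes f :: "'i \<Rightarrow> 'a::metric_space \<Rightarrow> real"
  assumes "\<And>p x y. p \<in> P \<Longrightarrow> f p x \<le> f p y + L * dist x y"
  shows "continuous_on S (\<lambda>x. INF p\<in>P. ereal (f p x))"
proof -
  define g where "g x = (INF p\<in>P. ereal (f p x))" for x
  have le: "g x \<le> g y + ereal (L * dist x y)" for x y
    unfolding g_def by (rule INF_lipschitz_le) (rule assms)
  have "(g \<longlongrightarrow> g a) (at a within S)" for a
  proof (rule tendsto_sandwich[where f = "\<lambda>x. g a + ereal (- (L * dist x a))"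
        and h = "\<lambda>x. g a + ereal (L * dist x a)"])
    have d: "((\<lambda>x. L * dist x a) \<longlongrightarrow> 0) (at a within S)"
      by (auto intro!: tendsto_eq_intros)
    have "((\<lambda>x. g a + ereal (L * dist x a)) \<longlongrightarrow> g a + ereal 0) (at a within S)"
      using d by (intro tendsto_add_ereal_general1) auto
    then show "((\<lambda>x. g a + ereal (L * dist x a)) \<longlongrightarrow> g a) (at a within S)"
      by simp
    have "((\<lambda>x. g a + ereal (- (L * dist x a))) \<longlongrightarrow> g a + ereal (- 0)) (at a within S)"
      using tendsto_minus[OF d] by (intro tendsto_add_ereal_general1) auto
    then show "((\<lambda>x. g a + ereal (- (L * dist x a))) \<longlongrightarrow> g a) (at a within S)"
      by simp
    show "\<forall>\<^sub>F x in at a within S. g x \<le> g a + ereal (L * dist x a)"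
      by (simp add: le)
    have "g a + ereal (- (L * dist x a)) \<le> g x" for x
      using le[of a x] by (cases "g a"; cases "g x") (auto simp: dist_commute)
    then show "\<forall>\<^sub>F x in at a within S. g a + ereal (- (L * dist x a)) \<le> g x"
      by simp
  qed
  then show ?thesis
    unfolding continuous_on_def by (simp add: g_def[abs_def])
qed

section \<open>Linearisation of a concave quadratic functional\<close>

text \<open>Any compact set containing all the minimisers \<open>C p / 2\<close> of the completed squares contains a
  minimiser of the joint problem. For an empty \<open>P\<close> both sides are \<open>\<infinity>\<close>.\<close>

lemma quadratic_linearisation:
  fixes K :: "'i \<Rightarrow> real" and C :: "'i \<Rightarrow> 'e::euclidean_space"
  assumes compact: "compact D" and ne: "D \<noteq> {}"
    and half: "\<And>p. p \<in> P \<Longrightarrow> (1/2) *\<^sub>R C p \<in> D"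
  defines "h \<equiv> \<lambda>A. ereal (32 * (norm A)\<^sup>2) + (INF p\<in>P. ereal (K p - 32 * (A \<bullet> C p)))"
  shows "(INF p\<in>P. ereal (K p - 8 * (norm (C p))\<^sup>2)) = (INF A. h A)"
    and "\<exists>A'\<in>D. h A' = (INF A. h A)"
proof -
  define S where "S = (INF p\<in>P. ereal (K p - 8 * (norm (C p))\<^sup>2))"
  obtain B where B: "\<And>A. A \<in> D \<Longrightarrow> norm A \<le> B"
    using compact_imp_bounded[OF compact] by (auto simp: bounded_iff)
  have "continuous_on D (\<lambda>A. INF p\<in>P. ereal (K p - 32 * (A \<bullet> C p)))"
  proof (rule continuous_on_INF_lipschitz[where L = "64 * B"])
    fix p A A' assume p: "p \<in> P"
    have "(A' - A) \<bullet> C p \<le> norm (A' - A) * norm (C p)"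
      by (rule norm_cauchy_schwarz)
    \<comment> \<open>Half of \<open>C p\<close> lies in \<open>D\<close>, so \<open>B\<close> controls the slope as well.\<close>
    also have "\<dots> \<le> norm (A' - A) * (2 * B)"
      using B[OF half[OF p]] by (intro mult_left_mono) auto
    finally show "K p - 32 * (A \<bullet> C p) \<le> K p - 32 * (A' \<bullet> C p) + 64 * B * dist A A'"
      by (simp add: inner_diff_left dist_norm norm_minus_commute[of A A'] algebra_simps)
  qed
  then have "continuous_on D h"
    unfolding h_def continuous_on_def
    by (auto intro!: tendsto_add_ereal_general2 tendsto_intros)
  then obtain A' where A': "A' \<in> D" and min: "\<And>A. A \<in> D \<Longrightarrow> h A' \<le> h A"
    using continuous_attains_inf[OF compact ne] by blast
  have S_le: "S \<le> h A" for A
  proof -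
    have "S - ereal (32 * (norm A)\<^sup>2) \<le> (INF p\<in>P. ereal (K p - 32 * (A \<bullet> C p)))"
    proof (rule INF_greatest)
      fix p assume p: "p \<in> P"
      have "0 \<le> 32 * (norm (A - (1/2) *\<^sub>R C p))\<^sup>2"
        by simp
      also have "\<dots> = 32 * (norm A)\<^sup>2 - 32 * (A \<bullet> C p) + 8 * (norm (C p))\<^sup>2"
        by (simp add: power2_norm_eq_inner inner_diff_left inner_diff_right inner_commute
            algebra_simps)
      finally have "ereal (K p - 8 * (norm (C p))\<^sup>2)
          \<le> ereal (K p - 32 * (A \<bullet> C p)) + ereal (32 * (norm A)\<^sup>2)"
        by simp
      moreover have "S \<le> ereal (K p - 8 * (norm (C p))\<^sup>2)"
        unfolding S_def using p by (rule INF_lower)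
      ultimately show "S - ereal (32 * (norm A)\<^sup>2) \<le> ereal (K p - 32 * (A \<bullet> C p))"
        by (subst ereal_minus_le) (auto intro: order_trans)
    qed
    then show ?thesis
      by (simp add: h_def ereal_minus_le add.commute)
  qed
  have "h A' \<le> S"
    unfolding S_def
  proof (rule INF_greatest)
    fix p assume p: "p \<in> P"
    let ?A = "(1/2) *\<^sub>R C p"
    have "h A' \<le> h ?A"
      using half[OF p] by (rule min)
    also have "\<dots> \<le> ereal (32 * (norm ?A)\<^sup>2) + ereal (K p - 32 * (?A \<bullet> C p))"
      unfolding h_def using p by (intro add_left_mono INF_lower)
    also have "\<dots> = ereal (K p - 8 * (norm (C p))\<^sup>2)"
      by (simp add: power2_norm_eq_inner[symmetric] power_divide)
    finally show "h A' \<le> ereal (K p - 8 * (norm (C p))\<^sup>2)" .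
  qed
  with S_le[of A'] have eq: "h A' = S"
    by (rule antisym[rotated])
  have Inf_h: "(INF A. h A) = S"
  proof (rule antisym)
    show "(INF A. h A) \<le> S"
      using INF_lower[of A' UNIV h] by (simp add: eq)
    show "S \<le> (INF A. h A)"
      by (intro INF_greatest S_le)
  qed
  show "(INF p\<in>P. ereal (K p - 8 * (norm (C p))\<^sup>2)) = (INF A. h A)"
    by (simp add: Inf_h S_def)
  show "\<exists>A'\<in>D. h A' = (INF A. h A)"
    using A' eq unfolding Inf_h by blast
qed

section \<open>Integrals against couplings\<close>

lemma integrable_mult_squares:
  fixes f g :: "'a \<Rightarrow> real"
  assumes [measurable]: "f \<in> borel_measurable M" "g \<in> borel_measurable M"
    and "integrable M (\<lambda>x. (f x)\<^sup>2)" "integrable M (\<lambda>x. (g x)\<^sup>2)"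
  shows "integrable M (\<lambda>x. f x * g x)"
proof (rule Bochner_Integration.integrable_bound)
  show "integrable M (\<lambda>x. (f x)\<^sup>2 + (g x)\<^sup>2)"
    using assms by simp
  have "\<bar>a * b\<bar> \<le> a\<^sup>2 + b\<^sup>2" for a b :: real
  proof -
    have "2 * \<bar>a * b\<bar> \<le> a\<^sup>2 + b\<^sup>2"
      using sum_squares_bound[of "\<bar>a\<bar>" "\<bar>b\<bar>"] by (simp add: abs_mult)
    then show ?thesis
      using abs_ge_zero[of "a * b"] by linarith
  qed
  then show "AE x in M. norm (f x * g x) \<le> norm ((f x)\<^sup>2 + (g x)\<^sup>2)"
    by simp
qed simp

lemma Cauchy_Schwarz_integral:
  fixes f g :: "'a \<Rightarrow> real"
  assumes [measurable]: "f \<in> borel_measurable M" "g \<in> borel_measurable M"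
    and f: "integrable M (\<lambda>x. (f x)\<^sup>2)" and g: "integrable M (\<lambda>x. (g x)\<^sup>2)"
  shows "\<bar>\<integral>x. f x * g x \<partial>M\<bar> \<le> sqrt ((\<integral>x. (f x)\<^sup>2 \<partial>M) * (\<integral>x. (g x)\<^sup>2 \<partial>M))"
proof -
  have int: "integrable M (\<lambda>x. f x * g x)"
    by (rule integrable_mult_squares) (use f g in auto)
  have "\<bar>\<integral>x. f x * g x \<partial>M\<bar> \<le> (\<integral>x. \<bar>f x * g x\<bar> \<partial>M)"
    by (rule integral_abs_bound)
  then have "\<bar>\<integral>x. f x * g x \<partial>M\<bar>\<^sup>2 \<le> (\<integral>x. \<bar>f x * g x\<bar> \<partial>M)\<^sup>2"
    by (rule power_mono) simp
  moreover have "ennreal ((\<integral>x. \<bar>f x * g x\<bar> \<partial>M)\<^sup>2) \<le>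
      ennreal ((\<integral>x. (f x)\<^sup>2 \<partial>M) * (\<integral>x. (g x)\<^sup>2 \<partial>M))"
  proof -
    have "ennreal ((\<integral>x. \<bar>f x * g x\<bar> \<partial>M)\<^sup>2) = (\<integral>\<^sup>+x. ennreal \<bar>f x\<bar> * ennreal \<bar>g x\<bar> \<partial>M)\<^sup>2"
      using nn_integral_eq_integral[OF integrable_abs[OF int]]
      by (simp add: ennreal_power[symmetric] abs_mult ennreal_mult)
    also have "\<dots> \<le> (\<integral>\<^sup>+x. (ennreal \<bar>f x\<bar>)\<^sup>2 \<partial>M) * (\<integral>\<^sup>+x. (ennreal \<bar>g x\<bar>)\<^sup>2 \<partial>M)"
      by (rule Cauchy_Schwarz_nn_integral) auto
    also have "\<dots> = ennreal ((\<integral>x. (f x)\<^sup>2 \<partial>M) * (\<integral>x. (g x)\<^sup>2 \<partial>M))"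
      using nn_integral_eq_integral[OF f] nn_integral_eq_integral[OF g]
      by (simp add: ennreal_mult ennreal_power)
    finally show ?thesis .
  qed
  ultimately show ?thesis
    by (intro real_le_rsqrt) (simp add: ennreal_le_iff)
qed

lemma prob_measures_4_second_moment:
  assumes "\<rho> \<in> prob_measures 4"
  shows "integrable \<rho> (\<lambda>x. (norm x)\<^sup>2)"
proof -
  interpret prob_space \<rho>
    using assms by (simp add: prob_measures_def)
  have [measurable_cong]: "sets \<rho> = sets borel"
    using assms by (simp add: prob_measures_def)
  show ?thesis
  proof (rule square_integrable_imp_integrable)
    show "integrable \<rho> (\<lambda>x. ((norm x)\<^sup>2)\<^sup>2)"
      using assms by (simp add: prob_measures_def power_mult[symmetric])
  qed simp_all
qed

lemma coupling_measurable:
  assumes "\<pi> \<in> couplings \<mu> \<nu>"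
  shows "fst \<in> measurable \<pi> borel" "snd \<in> measurable \<pi> borel"
proof -
  have [measurable_cong]: "sets \<pi> = sets (borel \<Otimes>\<^sub>M borel)"
    using assms unfolding borel_prod by (simp add: couplings_def)
  show "fst \<in> measurable \<pi> borel" "snd \<in> measurable \<pi> borel"
    by measurable
qed

text \<open>The change of variables formula for the two projections of a coupling.\<close>

lemma coupling_marginals:
  fixes f :: "'a::euclidean_space \<Rightarrow> real" and g :: "'b::euclidean_space \<Rightarrow> real"
  assumes \<pi>: "\<pi> \<in> couplings \<mu> \<nu>"
    and f: "f \<in> borel_measurable borel" and g: "g \<in> borel_measurable borel"
  shows "integrable \<pi> (\<lambda>z. f (fst z)) \<longleftrightarrow> integrable \<mu> f"
    and "integrable \<pi> (\<lambda>z. g (snd z)) \<longleftrightarrow> integrable \<nu> g"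
    and "(\<integral>z. f (fst z) \<partial>\<pi>) = (\<integral>x. f x \<partial>\<mu>)"
    and "(\<integral>z. g (snd z) \<partial>\<pi>) = (\<integral>y. g y \<partial>\<nu>)"
proof -
  have d: "distr \<pi> borel fst = \<mu>" "distr \<pi> borel snd = \<nu>"
    using \<pi> by (auto simp: couplings_def)
  note m = coupling_measurable[OF \<pi>]
  show "integrable \<pi> (\<lambda>z. f (fst z)) \<longleftrightarrow> integrable \<mu> f"
    using integrable_distr_eq[OF m(1) f] by (simp add: d)
  show "integrable \<pi> (\<lambda>z. g (snd z)) \<longleftrightarrow> integrable \<nu> g"
    using integrable_distr_eq[OF m(2) g] by (simp add: d)
  show "(\<integral>z. f (fst z) \<partial>\<pi>) = (\<integral>x. f x \<partial>\<mu>)"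
    using integral_distr[OF m(1) f] by (simp add: d)
  show "(\<integral>z. g (snd z) \<partial>\<pi>) = (\<integral>y. g y \<partial>\<nu>)"
    using integral_distr[OF m(2) g] by (simp add: d)
qed

text \<open>The matrix of mixed second moments of a coupling.\<close>

definition cross_correlation :: "((real ^ 'm) \<times> (real ^ 'n)) measure \<Rightarrow> real ^ 'n ^ 'm" where
  "cross_correlation \<pi> = (\<chi> i j. \<integral>z. fst z $ i * snd z $ j \<partial>\<pi>)"

lemma norm_cross_correlation:
  "(norm (cross_correlation \<pi>))\<^sup>2 = (\<Sum>i\<in>UNIV. \<Sum>j\<in>UNIV. (\<integral>(x, y). x $ i * y $ j \<partial>\<pi>)\<^sup>2)"
  unfolding power2_norm_eq_inner
  by (simp add: inner_vec_def cross_correlation_def power2_eq_square case_prod_beta')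

context
  fixes \<mu> :: "(real ^ 'm) measure" and \<nu> :: "(real ^ 'n) measure"
    and \<pi> :: "((real ^ 'm) \<times> (real ^ 'n)) measure"
  assumes \<mu>: "\<mu> \<in> prob_measures 4" and \<nu>: "\<nu> \<in> prob_measures 4"
    and \<pi>: "\<pi> \<in> couplings \<mu> \<nu>"
begin

lemmas coupling_borel [measurable] = coupling_measurable[OF \<pi>]

lemma coupling_integrable_norm_power:
  assumes "p = 2 \<or> p = 4"
  shows "integrable \<pi> (\<lambda>z. norm (fst z) ^ p)" "integrable \<pi> (\<lambda>z. norm (snd z) ^ p)"
  using assms \<mu> \<nu> prob_measures_4_second_moment[OF \<mu>] prob_measures_4_second_moment[OF \<nu>]
  by (auto simp: coupling_marginals(1)[OF \<pi>, of "\<lambda>x. norm x ^ _" "\<lambda>y. 0"]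
      coupling_marginals(2)[OF \<pi>, of "\<lambda>x. 0" "\<lambda>y. norm y ^ _"] prob_measures_def)

lemma coupling_integrable_quartic:
  "integrable \<pi> (\<lambda>z. (norm (fst z))\<^sup>2 * (norm (snd z))\<^sup>2)"
  using coupling_integrable_norm_power[of 4]
  by (intro integrable_mult_squares) (auto simp: power_mult[symmetric])

lemma coupling_measurable_components [measurable]:
  "(\<lambda>z. fst z $ i) \<in> borel_measurable \<pi>" "(\<lambda>z. snd z $ j) \<in> borel_measurable \<pi>"
  by (rule measurable_compose[OF coupling_borel(1)] measurable_compose[OF coupling_borel(2)],
      intro borel_measurable_continuous_onI continuous_intros)+

lemma component_square_le: "(x $ i)\<^sup>2 \<le> (norm x)\<^sup>2" for x :: "real ^ 'k"
  by (simp add: abs_le_square_iff[symmetric] component_le_norm_cart)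

lemma coupling_integrable_component_squares:
  "integrable \<pi> (\<lambda>z. (fst z $ i)\<^sup>2)" "integrable \<pi> (\<lambda>z. (snd z $ j)\<^sup>2)"
proof -
  show "integrable \<pi> (\<lambda>z. (fst z $ i)\<^sup>2)"
    by (rule Bochner_Integration.integrable_bound[OF coupling_integrable_norm_power(1)[of 2]])
       (simp_all add: component_square_le)
  show "integrable \<pi> (\<lambda>z. (snd z $ j)\<^sup>2)"
    by (rule Bochner_Integration.integrable_bound[OF coupling_integrable_norm_power(2)[of 2]])
       (simp_all add: component_square_le)
qed

lemma coupling_integrable_components:
  "integrable \<pi> (\<lambda>z. fst z $ i * snd z $ j)"
  by (intro integrable_mult_squares coupling_integrable_component_squares) measurable

lemma cross_correlation_bound:
  "\<bar>cross_correlation \<pi> $ i $ j\<bar> \<le> sqrt (moment 2 \<mu> * moment 2 \<nu>)"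
proof -
  have "\<bar>cross_correlation \<pi> $ i $ j\<bar>
      \<le> sqrt ((\<integral>z. (fst z $ i)\<^sup>2 \<partial>\<pi>) * (\<integral>z. (snd z $ j)\<^sup>2 \<partial>\<pi>))"
    unfolding cross_correlation_def vec_lambda_beta
    by (intro Cauchy_Schwarz_integral coupling_integrable_component_squares) measurable
  also have "\<dots> \<le> sqrt ((\<integral>z. (norm (fst z))\<^sup>2 \<partial>\<pi>) * (\<integral>z. (norm (snd z))\<^sup>2 \<partial>\<pi>))"
    by (intro real_sqrt_le_mono mult_mono integral_mono coupling_integrable_component_squares
        coupling_integrable_norm_power integral_nonneg_AE)
       (auto simp: component_square_le)
  also have "\<dots> = sqrt (moment 2 \<mu> * moment 2 \<nu>)"
    unfolding moment_def
    by (simp add: coupling_marginals(3)[OF \<pi>, of "\<lambda>x. (norm x)\<^sup>2" "\<lambda>y. 0"]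
        coupling_marginals(4)[OF \<pi>, of "\<lambda>x. 0" "\<lambda>y. (norm y)\<^sup>2"])
  finally show ?thesis .
qed

lemma half_cross_correlation_in_box:
  "(1/2) *\<^sub>R cross_correlation \<pi> \<in> matrix_box (sqrt (moment 2 \<mu> * moment 2 \<nu>))"
  using cross_correlation_bound by (auto simp: matrix_box_def abs_le_iff minus_le_iff)

lemma integral_cost:
  "(\<integral>(x, y). cost A x y \<partial>\<pi>) =
    (\<integral>(x, y). - 4 * (norm x)\<^sup>2 * (norm y)\<^sup>2 \<partial>\<pi>) - 32 * (A \<bullet> cross_correlation \<pi>)"
proof -
  have bilinear: "x \<bullet> (A *v y) = (\<Sum>i\<in>UNIV. \<Sum>j\<in>UNIV. A $ i $ j * (x $ i * y $ j))" for x y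
    by (simp add: inner_vec_def matrix_vector_mult_def sum_distrib_left algebra_simps)
  have int: "integrable \<pi> (\<lambda>z. \<Sum>i\<in>UNIV. \<Sum>j\<in>UNIV. A $ i $ j * (fst z $ i * snd z $ j))"
    by (intro Bochner_Integration.integrable_sum integrable_mult_right
        coupling_integrable_components)
  have "(\<integral>z. (\<Sum>i\<in>UNIV. \<Sum>j\<in>UNIV. A $ i $ j * (fst z $ i * snd z $ j)) \<partial>\<pi>)
      = A \<bullet> cross_correlation \<pi>"
    by (simp add: Bochner_Integration.integral_sum Bochner_Integration.integrable_sum
        coupling_integrable_components inner_vec_def cross_correlation_def)
  then show ?thesis
    using int coupling_integrable_quartic
    by (simp add: cost_def case_prod_beta' bilinear mult.assoc)
qed

end

section \<open>The variational formula\<close>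

lemma matrix_box_eq_cbox:
  "matrix_box M = cbox (\<chi> i j. - M / 2) (\<chi> i j. M / 2)"
  by (auto simp: matrix_box_def mem_box Basis_vec_def inner_axis)

theorem corollary1:
  fixes \<mu> :: "(real ^ 'm) measure" and \<nu> :: "(real ^ 'n) measure"
  assumes "\<mu> \<in> prob_measures 4" and "\<nu> \<in> prob_measures 4"
  shows "S2 \<mu> \<nu> = (INF A. ereal (32 * (frobenius_norm A)\<^sup>2) + OT A \<mu> \<nu>) \<and>
    (\<exists>A' \<in> matrix_box (sqrt (moment 2 \<mu> * moment 2 \<nu>)).
       ereal (32 * (frobenius_norm A')\<^sup>2) + OT A' \<mu> \<nu> =
         (INF A. ereal (32 * (frobenius_norm A)\<^sup>2) + OT A \<mu> \<nu>))"
proof -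
  let ?D = "matrix_box (sqrt (moment 2 \<mu> * moment 2 \<nu>)) :: (real ^ 'n ^ 'm) set"
  define K where "K \<pi> = (\<integral>(x, y). - 4 * (norm x)\<^sup>2 * (norm y)\<^sup>2 \<partial>\<pi>)"
    for \<pi> :: "((real ^ 'm) \<times> (real ^ 'n)) measure"
  have S2: "S2 \<mu> \<nu> =
      (INF \<pi>\<in>couplings \<mu> \<nu>. ereal (K \<pi> - 8 * (norm (cross_correlation \<pi>))\<^sup>2))"
    by (simp add: S2_def K_def norm_cross_correlation)
  have OT: "OT A \<mu> \<nu> =
      (INF \<pi>\<in>couplings \<mu> \<nu>. ereal (K \<pi> - 32 * (A \<bullet> cross_correlation \<pi>)))" for A
    unfolding OT_def K_def by (intro INF_cong refl) (simp only: integral_cost[OF assms])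
  have "compact ?D"
    by (simp add: matrix_box_eq_cbox)
  moreover have "0 \<in> ?D"
    by (simp add: matrix_box_def moment_def integral_nonneg_AE)
  ultimately show ?thesis
    unfolding S2 OT frobenius_norm_eq_norm
    using half_cross_correlation_in_box[OF assms]
    by (intro conjI quadratic_linearisation) auto
qed

end
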